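(* Let $n>2$ be an integer, let $G=\mathrm{Dc}_n$, and let $\varphi_{(r,s)},\varphi_{(p,q)}\in\mathrm{Aut}(G)$ with $r,p\in\mathcal{U}_{2n}$ and $s,q\in\mathbb{Z}_{2n}$. Then $\varphi_{(r,s)}$ and $\varphi_{(p,q)}$ are isomorphic if and only if $r=p$ and there exists $u\in\mathcal{U}_{2n}$ such that $qu-s$ is a multiple of $r-1$ in $\mathbb{Z}_{2n}$.
   Context: $\mathrm{Dc}_n=\langle x,y \mid x^{2n}=1,\ y^2=x^n,\ y^{-1}xy=x^{-1}\rangle$ is the dicyclic group of order $4n$. $\mathcal{U}_{2n}$ denotes the set of units of $\mathbb{Z}_{2n}$ (integers modulo $2n$). For $n>2$, every automorphism of $\mathrm{Dc}_n$ can be written uniquely as $\varphi_{(r,s)}$ with $r\in\mathcal{U}_{2n}$, $s\in\mathbb{Z}_{2n}$, where $\varphi_{(r,s)}(x)=x^r$ and $\varphi_{(r,s)}(y)=yx^s$. Two automorphisms $\varphi,\vartheta$ of $G$ are called isomorphic if there exists $\sigma\in\mathrm{Aut}(G)$ such that $\sigma\varphi=\vartheta\sigma$. *)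

theory Defs
  imports
    "HOL-Algebra.Bij"
    "HOL-Algebra.Divisibility"
    "HOL-Number_Theory.Residues"
begin

section \<open>Groups given by generators and relations\<close>

text \<open>The letter \<open>(g, True)\<close> stands for the generator \<open>g\<close> and \<open>(g, False)\<close> for its
  formal inverse.\<close>

type_synonym 'g gword = "('g \<times> bool) list"

text \<open>The congruence on words whose quotient is the group presented by the generators
  \<open>'g\<close> and the relations \<open>u = v\<close>, \<open>(u, v) \<in> R\<close>.\<close>

inductive word_eq :: "('g gword \<times> 'g gword) set \<Rightarrow> 'g gword \<Rightarrow> 'g gword \<Rightarrow> bool"
  for R where
  relation: "(u, v) \<in> R \<Longrightarrow> word_eq R u v"
| cancel: "word_eq R [(g, b), (g, \<not> b)] []"
| append: "word_eq R u u' \<Longrightarrow> word_eq R v v' \<Longrightarrow> word_eq R (u @ v) (u' @ v')"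
| refl: "word_eq R u u"
| sym: "word_eq R u v \<Longrightarrow> word_eq R v u"
| trans: "word_eq R u v \<Longrightarrow> word_eq R v w \<Longrightarrow> word_eq R u w"

definition word_class :: "('g gword \<times> 'g gword) set \<Rightarrow> 'g gword \<Rightarrow> 'g gword set" where
  "word_class R u = {v. word_eq R u v}"

definition presented_group :: "('g gword \<times> 'g gword) set \<Rightarrow> 'g gword set monoid" where
  "presented_group R =
     \<lparr>carrier = range (word_class R),
      monoid.mult = (\<lambda>A B. \<Union>u\<in>A. \<Union>v\<in>B. word_class R (u @ v)),
      one = word_class R []\<rparr>"

lemma word_class_eq_iff: "word_class R u = word_class R v \<longleftrightarrow> word_eq R u v"
proof
  assume "word_class R u = word_class R v"
  moreover have "v \<in> word_class R v" by (simp add: word_class_def word_eq.refl)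
  ultimately have "v \<in> word_class R u" by simp
  then show "word_eq R u v" by (simp add: word_class_def)
next
  assume "word_eq R u v"
  then have "word_eq R u w \<longleftrightarrow> word_eq R v w" for w
    by (meson word_eq.sym word_eq.trans)
  then show "word_class R u = word_class R v" by (simp add: word_class_def)
qed

lemma presented_group_one: "\<one>\<^bsub>presented_group R\<^esub> = word_class R []"
  by (simp add: presented_group_def)

lemma presented_group_mult:
  "word_class R u \<otimes>\<^bsub>presented_group R\<^esub> word_class R v = word_class R (u @ v)"
proof -
  have "word_class R (u' @ v') = word_class R (u @ v)"
    if "u' \<in> word_class R u" "v' \<in> word_class R v" for u' v'
    using that word_eq.append[of R u u' v v']
    by (metis mem_Collect_eq word_class_def word_class_eq_iff)
  moreover have "u \<in> word_class R u" "v \<in> word_class R v"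
    by (simp_all add: word_class_def word_eq.refl)
  ultimately have "(\<Union>u'\<in>word_class R u. \<Union>v'\<in>word_class R v. word_class R (u' @ v'))
      = word_class R (u @ v)"
    by blast
  then show ?thesis by (simp add: presented_group_def)
qed

lemma word_eq_inverse: "word_eq R (map (\<lambda>(g, b). (g, \<not> b)) (rev w) @ w) []"
proof (induction w)
  case Nil
  show ?case by (simp add: word_eq.refl)
next
  case (Cons a w)
  obtain g b where a: "a = (g, b)" by force
  let ?w' = "map (\<lambda>(g, b). (g, \<not> b)) (rev w)"
  have "word_eq R ([(g, \<not> b), (g, b)] @ w) ([] @ w)"
    using word_eq.cancel[of R g "\<not> b"] by (intro word_eq.append word_eq.refl) simp
  then have "word_eq R (?w' @ [(g, \<not> b), (g, b)] @ w) (?w' @ w)"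
    by (intro word_eq.append word_eq.refl) simp
  from word_eq.trans[OF this Cons.IH] a show ?case by simp
qed

lemma group_presented_group: "group (presented_group R)"
proof (rule groupI)
  fix A assume "A \<in> carrier (presented_group R)"
  then obtain w where "A = word_class R w" by (auto simp: presented_group_def)
  then have "word_class R (map (\<lambda>(g, b). (g, \<not> b)) (rev w)) \<otimes>\<^bsub>presented_group R\<^esub> A
      = \<one>\<^bsub>presented_group R\<^esub>"
    using word_eq_inverse[of R w]
    by (simp add: presented_group_mult word_class_eq_iff presented_group_one)
  then show "\<exists>B\<in>carrier (presented_group R). B \<otimes>\<^bsub>presented_group R\<^esub> A = \<one>\<^bsub>presented_group R\<^esub>"
    by (auto simp: presented_group_def)
next
  fix A B assume "A \<in> carrier (presented_group R)" "B \<in> carrier (presented_group R)"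
  then obtain u v where "A = word_class R u" "B = word_class R v"
    by (auto simp: presented_group_def)
  then have "A \<otimes>\<^bsub>presented_group R\<^esub> B = word_class R (u @ v)"
    by (simp add: presented_group_mult)
  then show "A \<otimes>\<^bsub>presented_group R\<^esub> B \<in> carrier (presented_group R)"
    by (simp add: presented_group_def)
next
  fix A B C
  assume "A \<in> carrier (presented_group R)" "B \<in> carrier (presented_group R)"
    "C \<in> carrier (presented_group R)"
  then obtain u v w where "A = word_class R u" "B = word_class R v" "C = word_class R w"
    by (auto simp: presented_group_def)
  then show "A \<otimes>\<^bsub>presented_group R\<^esub> B \<otimes>\<^bsub>presented_group R\<^esub> C
      = A \<otimes>\<^bsub>presented_group R\<^esub> (B \<otimes>\<^bsub>presented_group R\<^esub> C)"
    by (simp add: presented_group_mult)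
next
  show "\<one>\<^bsub>presented_group R\<^esub> \<in> carrier (presented_group R)"
    by (simp add: presented_group_def)
next
  fix A assume "A \<in> carrier (presented_group R)"
  then obtain w where "A = word_class R w" by (auto simp: presented_group_def)
  then show "\<one>\<^bsub>presented_group R\<^esub> \<otimes>\<^bsub>presented_group R\<^esub> A = A"
    by (simp add: presented_group_one presented_group_mult)
qed


section \<open>Dicyclic groups and their automorphisms\<close>

datatype dc_gen = Gen_x | Gen_y

definition dc_relations :: "nat \<Rightarrow> (dc_gen gword \<times> dc_gen gword) set" where
  "dc_relations n =
     {(replicate (2 * n) (Gen_x, True), []),
      ([(Gen_y, True), (Gen_y, True)], replicate n (Gen_x, True)),
      ([(Gen_y, False), (Gen_x, True), (Gen_y, True)], [(Gen_x, False)])}"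

definition Dc :: "nat \<Rightarrow> dc_gen gword set monoid" where
  "Dc n = presented_group (dc_relations n)"

definition dc_x :: "nat \<Rightarrow> dc_gen gword set" where
  "dc_x n = word_class (dc_relations n) [(Gen_x, True)]"

definition dc_y :: "nat \<Rightarrow> dc_gen gword set" where
  "dc_y n = word_class (dc_relations n) [(Gen_y, True)]"

text \<open>The integers modulo \<open>2n\<close>, with carrier \<open>{0..2n-1}\<close>.\<close>

abbreviation Z2n :: "nat \<Rightarrow> int ring" where
  "Z2n n \<equiv> residue_ring (int (2 * n))"

text \<open>The automorphism \<open>\<phi>\<^sub>(\<^sub>r\<^sub>,\<^sub>s\<^sub>)\<close>. The elements of \<^term>\<open>auto G\<close> are extensional on
  \<^term>\<open>carrier G\<close>, so the values on \<open>x\<close> and \<open>y\<close> leave at most one candidate.\<close>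

definition dc_aut :: "nat \<Rightarrow> int \<Rightarrow> int \<Rightarrow> dc_gen gword set \<Rightarrow> dc_gen gword set" where
  "dc_aut n r s = (THE \<phi>. \<phi> \<in> auto (Dc n) \<and>
     \<phi> (dc_x n) = dc_x n [^]\<^bsub>Dc n\<^esub> r \<and>
     \<phi> (dc_y n) = dc_y n \<otimes>\<^bsub>Dc n\<^esub> (dc_x n [^]\<^bsub>Dc n\<^esub> s))"

definition isomorphic_auts :: "('a, 'b) monoid_scheme \<Rightarrow> ('a \<Rightarrow> 'a) \<Rightarrow> ('a \<Rightarrow> 'a) \<Rightarrow> bool" where
  "isomorphic_auts G \<phi> \<theta> \<longleftrightarrow> \<phi> \<in> auto G \<and> \<theta> \<in> auto G \<and>
     (\<exists>\<sigma>\<in>auto G. compose (carrier G) \<sigma> \<phi> = compose (carrier G) \<theta> \<sigma>)"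

end

theory Submission
  imports Defs
begin

text \<open>Write \<open>x\<close>, \<open>y\<close> for the generators of \<open>Dc n\<close> and \<open>m = 2 * n\<close>. Everything rests on the normal
  form: each element is \<open>x^k\<close> or \<open>y x^k\<close> with \<open>k\<close> unique modulo \<open>m\<close>, and no element has both
  shapes. Existence follows from the relations by moving powers of \<open>x\<close> to the right
  (\<open>Dc_cases\<close>). Uniqueness says that the relations do not collapse the group; it is read off from
  a concrete group of order \<open>4 * n\<close> in which they hold (\<open>Dc_to_model\<close>).

  For \<open>n > 2\<close> an automorphism \<open>\<sigma>\<close> cannot send \<open>x\<close>, of order \<open>m > 4\<close>, to some \<open>y x^k\<close>, of order 4.
  So \<open>\<sigma>(x) = x^a\<close>, surjectivity forces \<open>\<sigma>(y) = y x^b\<close>, and \<open>a\<close> is a unit modulo \<open>m\<close>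
  (\<open>auto_Dc_cases\<close>). Conversely each unit \<open>a\<close> and each \<open>b\<close> give an automorphism
  \<open>\<phi>(a,b)\<close>, since \<open>x^a\<close> and \<open>y x^b\<close> satisfy the dicyclic relations again
  (\<open>Dc_automorphism_exists\<close>).

  Two homomorphisms agree as soon as they agree on \<open>x\<close> and \<open>y\<close>, so for \<open>\<sigma> = \<phi>(a,b)\<close> the equation
  \<open>\<sigma> \<phi>(r,s) = \<phi>(p,q) \<sigma>\<close> amounts to the congruences \<open>a r = p a\<close> and \<open>b + a s = q + p b\<close> modulo \<open>m\<close>.
  As \<open>a\<close> is a unit, the first says \<open>r = p\<close>. Multiplying the second by the inverse \<open>u\<close> of \<open>a\<close> turns it
  into \<open>q u - s = (r - 1) (- u b)\<close>, and as \<open>b\<close> varies the factor \<open>- u b\<close> is arbitrary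
  (\<open>conjugacy_cong_iff\<close>).\<close>

section \<open>The universal property of a presented group\<close>

definition word_value :: "('a, 'b) monoid_scheme \<Rightarrow> ('g \<Rightarrow> 'a) \<Rightarrow> 'g gword \<Rightarrow> 'a" where
  "word_value H f w =
     foldr (\<lambda>(g, b) a. (if b then f g else inv\<^bsub>H\<^esub> f g) \<otimes>\<^bsub>H\<^esub> a) w \<one>\<^bsub>H\<^esub>"

lemma word_value_Nil [simp]: "word_value H f [] = \<one>\<^bsub>H\<^esub>"
  by (simp add: word_value_def)

lemma word_value_Cons [simp]:
  "word_value H f ((g, b) # w) = (if b then f g else inv\<^bsub>H\<^esub> f g) \<otimes>\<^bsub>H\<^esub> word_value H f w"
  by (simp add: word_value_def)

context group
begin

lemma word_value_closed [simp]:
  assumes "\<And>g. f g \<in> carrier G"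
  shows "word_value G f w \<in> carrier G"
  by (induction w) (use assms in auto)

lemma word_value_append:
  assumes "\<And>g. f g \<in> carrier G"
  shows "word_value G f (u @ v) = word_value G f u \<otimes> word_value G f v"
  by (induction u) (use assms in \<open>auto simp: m_assoc\<close>)

lemma word_value_replicate:
  assumes "\<And>g. f g \<in> carrier G"
  shows "word_value G f (replicate k (g, True)) = f g [^] k"
proof (induction k)
  case (Suc k)
  then show ?case using nat_pow_Suc2[OF assms, of g k] by simp
qed simp

text \<open>The rules that generate \<open>word_eq R\<close> are sound in any group that satisfies the relations.\<close>

lemma word_value_cong:
  assumes f: "\<And>g. f g \<in> carrier G"
    and R: "\<And>u v. (u, v) \<in> R \<Longrightarrow> word_value G f u = word_value G f v"
    and "word_eq R u v"
  shows "word_value G f u = word_value G f v"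
  using assms(3) by induction (use f R in \<open>auto simp: word_value_append\<close>)

text \<open>Von Dyck's theorem: an assignment of the generators that respects the relations extends to a
  homomorphism. It serves twice, to build endomorphisms of the dicyclic group and to map this group
  to a concrete one.\<close>

lemma presented_group_lift:
  assumes f: "\<And>g. f g \<in> carrier G"
    and R: "\<And>u v. (u, v) \<in> R \<Longrightarrow> word_value G f u = word_value G f v"
  obtains h where "h \<in> hom (presented_group R) G"
    and "\<And>w. h (word_class R w) = word_value G f w"
proof
  \<comment> \<open>Evaluate any representative of the class; the value does not depend on the choice.\<close>
  let ?h = "\<lambda>A. word_value G f (SOME w. A = word_class R w)"
  show val: "?h (word_class R w) = word_value G f w" for w
  proof -
    have "word_class R w = word_class R (SOME v. word_class R w = word_class R v)"
      by (rule someI) (rule HOL.refl)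
    then show ?thesis
      using word_value_cong[OF f R] by (metis word_class_eq_iff)
  qed
  show "?h \<in> hom (presented_group R) G"
  proof (rule homI)
    fix A assume "A \<in> carrier (presented_group R)"
    then show "?h A \<in> carrier G" using f by simp
  next
    fix A B assume "A \<in> carrier (presented_group R)" "B \<in> carrier (presented_group R)"
    then obtain u v where AB: "A = word_class R u" "B = word_class R v"
      by (auto simp: presented_group_def)
    show "?h (A \<otimes>\<^bsub>presented_group R\<^esub> B) = ?h A \<otimes> ?h B"
      unfolding AB presented_group_mult val using f by (rule word_value_append)
  qed
qed

end

lemma word_class_in_carrier [simp]: "word_class R w \<in> carrier (presented_group R)"
  by (simp add: presented_group_def)

lemma inv_word_class_generator:
  "inv\<^bsub>presented_group R\<^esub> word_class R [(g, True)] = word_class R [(g, False)]"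
proof -
  interpret group "presented_group R" by (rule group_presented_group)
  have "word_class R [(g, False)] \<otimes>\<^bsub>presented_group R\<^esub> word_class R [(g, True)] =
      \<one>\<^bsub>presented_group R\<^esub>"
    using word_eq.cancel[of R g False]
    by (simp add: presented_group_mult presented_group_one word_class_eq_iff)
  then show ?thesis by (simp add: inv_equality)
qed

text \<open>The generators and their inverses generate the group; as words are read from the
  left, left multiplication is the natural form of the induction step.\<close>

lemma presented_group_induct [consumes 1, case_names one gen inv_gen]:
  assumes "A \<in> carrier (presented_group R)"
    and "P \<one>\<^bsub>presented_group R\<^esub>"
    and "\<And>g B. B \<in> carrier (presented_group R) \<Longrightarrow> P B \<Longrightarrow>
      P (word_class R [(g, True)] \<otimes>\<^bsub>presented_group R\<^esub> B)"
    and "\<And>g B. B \<in> carrier (presented_group R) \<Longrightarrow> P B \<Longrightarrow>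
      P (inv\<^bsub>presented_group R\<^esub> word_class R [(g, True)] \<otimes>\<^bsub>presented_group R\<^esub> B)"
  shows "P A"
proof -
  have "P (word_class R w)" for w
  proof (induction w)
    case Nil
    then show ?case using assms(2) by (simp add: presented_group_one)
  next
    case (Cons a w)
    obtain g b where a: "a = (g, b)" by force
    have "word_class R (a # w) = word_class R [(g, b)] \<otimes>\<^bsub>presented_group R\<^esub> word_class R w"
      by (simp add: a presented_group_mult)
    then show ?case
      using assms(3,4)[OF word_class_in_carrier Cons.IH, of g]
      by (cases b) (simp_all add: inv_word_class_generator)
  qed
  then show ?thesis using assms(1) by (auto simp: presented_group_def)
qed


section \<open>Consequences of the dicyclic relations\<close>

text \<open>The relations are considered for a pair of elements in an arbitrary group, because they are met in
  three places: by the generators of \<open>Dc n\<close>, by the images of these under an intended automorphism,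
  and by a pair in a concrete model.\<close>

locale dicyclic_relations = group G for G (structure) +
  fixes x y :: 'a and n :: nat
  assumes x_closed [simp]: "x \<in> carrier G" and y_closed [simp]: "y \<in> carrier G"
    and x_pow_2n: "x [^] (2 * n) = \<one>"
    and y_square: "y \<otimes> y = x [^] n"
    and x_conj: "inv y \<otimes> x \<otimes> y = inv x"
begin

lemma x_pow_n_int: "x [^] n = x [^] int n"
  by (simp add: int_pow_int)

lemma x_pow_cong:
  assumes "[i = j] (mod int (2 * n))"
  shows "x [^] i = x [^] j"
proof -
  obtain k where "i = j + int (2 * n) * k"
    using assms by (metis cong_iff_lin cong_sym)
  moreover have "x [^] (int (2 * n) * k) = \<one>"
    using x_pow_2n by (simp only: int_pow_pow[symmetric] x_closed int_pow_int int_pow_one)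
  ultimately show ?thesis by (simp add: int_pow_mult)
qed

text \<open>Conjugation by \<open>y\<close> is a homomorphism that inverts \<open>x\<close>, hence it inverts all powers of \<open>x\<close>.\<close>

lemma x_pow_mult_y: "x [^] k \<otimes> y = y \<otimes> x [^] (- k)" for k :: int
proof -
  have "(\<lambda>g. inv y \<otimes> g \<otimes> y) \<in> hom G G"
  proof (rule homI)
    fix g h assume "g \<in> carrier G" "h \<in> carrier G"
    then show "inv y \<otimes> (g \<otimes> h) \<otimes> y = (inv y \<otimes> g \<otimes> y) \<otimes> (inv y \<otimes> h \<otimes> y)"
      by (simp add: m_assoc[symmetric]) (simp add: m_assoc)
  qed simp
  then have "inv y \<otimes> x [^] k \<otimes> y = (inv y \<otimes> x \<otimes> y) [^] k"
    using hom_int_pow[OF _ x_closed is_group is_group] by fastforce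
  also have "\<dots> = x [^] (- k)"
    by (simp add: x_conj int_pow_inv int_pow_neg)
  finally show ?thesis
    by (simp add: m_assoc inv_solve_left')
qed

lemma y_mult_y_x_pow: "y \<otimes> (y \<otimes> x [^] k) = x [^] (int n + k)" for k :: int
  by (simp add: m_assoc[symmetric] y_square x_pow_n_int int_pow_mult)

text \<open>Moving \<open>y\<close> past \<open>x^k\<close> inverts that power, so the two powers of \<open>x\<close> cancel. Hence every
  \<open>y x^k\<close> has the same square as \<open>y\<close>, and order dividing 4.\<close>

lemma y_x_pow_square: "(y \<otimes> x [^] k) \<otimes> (y \<otimes> x [^] k) = x [^] int n" for k :: int
proof -
  have "(y \<otimes> x [^] k) \<otimes> (y \<otimes> x [^] k) = y \<otimes> (x [^] k \<otimes> y) \<otimes> x [^] k"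
    by (simp add: m_assoc)
  also have "\<dots> = y \<otimes> (y \<otimes> x [^] (- k)) \<otimes> x [^] k"
    by (simp only: x_pow_mult_y)
  also have "\<dots> = (y \<otimes> y) \<otimes> (x [^] (- k) \<otimes> x [^] k)"
    by (simp add: m_assoc)
  also have "\<dots> = x [^] int n"
    by (simp add: int_pow_mult[symmetric] y_square x_pow_n_int)
  finally show ?thesis .
qed

lemma inv_y: "inv y = y \<otimes> x [^] int n"
proof (rule inv_equality)
  have "y \<otimes> x [^] int n \<otimes> y = y \<otimes> (y \<otimes> x [^] (- int n))"
    by (simp add: m_assoc x_pow_mult_y)
  then show "y \<otimes> x [^] int n \<otimes> y = \<one>"
    by (simp add: y_mult_y_x_pow)
qed simp_all

text \<open>The square of \<open>y x^s\<close> is \<open>x^n\<close>, while \<open>(x^r)^n = x^(n r)\<close>; these agree because \<open>n r\<close> and \<open>n\<close>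
  differ by a multiple of \<open>2 n\<close> when \<open>r\<close> is odd.\<close>

lemma dicyclic_relations_image:
  fixes r s :: int
  assumes "odd r"
  shows "dicyclic_relations G (x [^] r) (y \<otimes> x [^] s) n"
proof
  have "(x [^] r) [^] (2 * n) = x [^] (int (2 * n) * r)"
    by (simp add: int_pow_int[symmetric] int_pow_pow mult.commute)
  also have "\<dots> = x [^] (0::int)" by (rule x_pow_cong) (simp add: cong_def)
  finally show "(x [^] r) [^] (2 * n) = \<one>" by simp
next
  have "(x [^] r) [^] n = x [^] (int n * r)"
    by (simp add: int_pow_int[symmetric] int_pow_pow mult.commute)
  also have "\<dots> = x [^] int n"
  proof (rule x_pow_cong)
    obtain k where "r = 2 * k + 1" using assms by (rule oddE)
    then have "int n * r = int n + int (2 * n) * k" by (simp add: algebra_simps)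
    then show "[int n * r = int n] (mod int (2 * n))" by (simp add: cong_def)
  qed
  finally show "(y \<otimes> x [^] s) \<otimes> (y \<otimes> x [^] s) = (x [^] r) [^] n"
    by (simp add: y_x_pow_square)
next
  have "x [^] r \<otimes> (y \<otimes> x [^] s) = x [^] r \<otimes> y \<otimes> x [^] s"
    by (simp add: m_assoc)
  also have "\<dots> = y \<otimes> (x [^] (- r) \<otimes> x [^] s)"
    by (simp add: x_pow_mult_y m_assoc)
  also have "\<dots> = y \<otimes> x [^] s \<otimes> inv (x [^] r)"
    by (simp add: m_assoc int_pow_mult[symmetric] int_pow_neg[symmetric])
  finally show "inv (y \<otimes> x [^] s) \<otimes> x [^] r \<otimes> (y \<otimes> x [^] s) = inv (x [^] r)"
    by (simp add: m_assoc inv_solve_left')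
qed simp_all

lemma Dc_lift:
  obtains h where "h \<in> hom (Dc n) G" "h (dc_x n) = x" "h (dc_y n) = y"
proof -
  let ?f = "case_dc_gen x y"
  have f: "?f g \<in> carrier G" for g by (cases g) simp_all
  have R: "word_value G ?f u = word_value G ?f v" if "(u, v) \<in> dc_relations n" for u v
    using that x_pow_2n y_square x_conj
    by (auto simp: dc_relations_def word_value_replicate[OF f] m_assoc)
  obtain h where "h \<in> hom (presented_group (dc_relations n)) G"
    "\<And>w. h (word_class (dc_relations n) w) = word_value G ?f w"
    using presented_group_lift[of ?f "dc_relations n", OF f R] by blast
  then show ?thesis by (intro that[of h]) (simp_all add: Dc_def dc_x_def dc_y_def)
qed

end


section \<open>Normal forms in the dicyclic group\<close>

lemma group_Dc: "group (Dc n)"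
  by (simp add: Dc_def group_presented_group)

interpretation Dc: dicyclic_relations "Dc n" "dc_x n" "dc_y n" n for n
proof -
  interpret group "Dc n" by (rule group_Dc)
  let ?c = "word_class (dc_relations n)"
  have x: "dc_x n \<in> carrier (Dc n)" and y: "dc_y n \<in> carrier (Dc n)"
    by (simp_all add: Dc_def dc_x_def dc_y_def)
  have pow: "dc_x n [^]\<^bsub>Dc n\<^esub> k = ?c (replicate k (Gen_x, True))" for k :: nat
  proof (induction k)
    case 0
    then show ?case by (simp add: Dc_def presented_group_one)
  next
    case (Suc k)
    have "dc_x n [^]\<^bsub>Dc n\<^esub> Suc k = dc_x n \<otimes>\<^bsub>Dc n\<^esub> ?c (replicate k (Gen_x, True))"
      unfolding Suc.IH[symmetric] using x by (rule nat_pow_Suc2)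
    then show ?case by (simp add: Dc_def dc_x_def presented_group_mult)
  qed
  have rel: "?c (replicate (2 * n) (Gen_x, True)) = ?c []"
    "?c [(Gen_y, True), (Gen_y, True)] = ?c (replicate n (Gen_x, True))"
    "?c [(Gen_y, False), (Gen_x, True), (Gen_y, True)] = ?c [(Gen_x, False)]"
    unfolding word_class_eq_iff by (rule word_eq.relation; simp add: dc_relations_def)+
  show "dicyclic_relations (Dc n) (dc_x n) (dc_y n) n"
  proof
    show "dc_x n [^]\<^bsub>Dc n\<^esub> (2 * n) = \<one>\<^bsub>Dc n\<^esub>"
      unfolding pow by (simp add: Dc_def presented_group_one rel)
    show "dc_y n \<otimes>\<^bsub>Dc n\<^esub> dc_y n = dc_x n [^]\<^bsub>Dc n\<^esub> n"
      unfolding pow by (simp add: Dc_def dc_y_def presented_group_mult rel)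
    show "inv\<^bsub>Dc n\<^esub> dc_y n \<otimes>\<^bsub>Dc n\<^esub> dc_x n \<otimes>\<^bsub>Dc n\<^esub> dc_y n = inv\<^bsub>Dc n\<^esub> dc_x n"
      by (simp add: Dc_def dc_x_def dc_y_def inv_word_class_generator presented_group_mult
          rel)
  qed (use x y in simp_all)
qed

lemma Dc_induct [consumes 1, case_names one x inv_x y inv_y]:
  assumes "g \<in> carrier (Dc n)"
    and "P \<one>\<^bsub>Dc n\<^esub>"
    and "\<And>g. g \<in> carrier (Dc n) \<Longrightarrow> P g \<Longrightarrow> P (dc_x n \<otimes>\<^bsub>Dc n\<^esub> g)"
    and "\<And>g. g \<in> carrier (Dc n) \<Longrightarrow> P g \<Longrightarrow> P (inv\<^bsub>Dc n\<^esub> dc_x n \<otimes>\<^bsub>Dc n\<^esub> g)"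
    and "\<And>g. g \<in> carrier (Dc n) \<Longrightarrow> P g \<Longrightarrow> P (dc_y n \<otimes>\<^bsub>Dc n\<^esub> g)"
    and "\<And>g. g \<in> carrier (Dc n) \<Longrightarrow> P g \<Longrightarrow> P (inv\<^bsub>Dc n\<^esub> dc_y n \<otimes>\<^bsub>Dc n\<^esub> g)"
  shows "P g"
proof -
  from assms(1) have "g \<in> carrier (presented_group (dc_relations n))" by (simp add: Dc_def)
  then show ?thesis
  proof (induction rule: presented_group_induct)
    case one
    then show ?case using assms(2) by (simp add: Dc_def)
  next
    case (gen a B)
    then show ?case using assms(3,5)[of B]
      by (cases a) (simp_all add: Dc_def dc_x_def dc_y_def)
  next
    case (inv_gen a B)
    then show ?case using assms(4,6)[of B]
      by (cases a) (simp_all add: Dc_def dc_x_def dc_y_def)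
  qed
qed

text \<open>The elements \<open>x^k\<close> and \<open>y x^k\<close> include the identity and are permuted by left multiplication with
  the generators and their inverses, so they exhaust the group.\<close>

lemma Dc_cases:
  assumes "g \<in> carrier (Dc n)"
  obtains (x) k :: int where "g = dc_x n [^]\<^bsub>Dc n\<^esub> k"
    | (y) k :: int where "g = dc_y n \<otimes>\<^bsub>Dc n\<^esub> dc_x n [^]\<^bsub>Dc n\<^esub> k"
proof -
  let ?x = "\<lambda>k::int. dc_x n [^]\<^bsub>Dc n\<^esub> k" and ?y = "\<lambda>k::int. dc_y n \<otimes>\<^bsub>Dc n\<^esub> dc_x n [^]\<^bsub>Dc n\<^esub> k"
  note [simp] = Dc.m_assoc Dc.x_closed Dc.y_closed
  have pow_x: "?x i \<otimes>\<^bsub>Dc n\<^esub> ?x k = ?x (i + k)" for i k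
    by (simp add: Dc.int_pow_mult)
  have pow_y: "?x i \<otimes>\<^bsub>Dc n\<^esub> ?y k = ?y (k - i)" for i k
  proof -
    have "?x i \<otimes>\<^bsub>Dc n\<^esub> ?y k = ?x i \<otimes>\<^bsub>Dc n\<^esub> dc_y n \<otimes>\<^bsub>Dc n\<^esub> ?x k"
      by simp
    also have "\<dots> = dc_y n \<otimes>\<^bsub>Dc n\<^esub> (?x (- i) \<otimes>\<^bsub>Dc n\<^esub> ?x k)"
      unfolding Dc.x_pow_mult_y by simp
    finally show ?thesis by (simp add: pow_x)
  qed
  have x1: "dc_x n = ?x 1" and x2: "inv\<^bsub>Dc n\<^esub> dc_x n = ?x (- 1)"
    by (simp_all add: Dc.int_pow_neg)
  from assms have "(\<exists>k. g = ?x k) \<or> (\<exists>k. g = ?y k)"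
  proof (induction rule: Dc_induct)
    case one
    have "\<one>\<^bsub>Dc n\<^esub> = ?x 0" by simp
    then show ?case by blast
  next
    case (x g)
    then show ?case by (metis pow_x pow_y x1)
  next
    case (inv_x g)
    then show ?case by (metis pow_x pow_y x2)
  next
    case (y g)
    then show ?case by (metis Dc.y_mult_y_x_pow)
  next
    case (inv_y g)
    have "inv\<^bsub>Dc n\<^esub> dc_y n \<otimes>\<^bsub>Dc n\<^esub> ?x k = ?y (int n + k)" for k
      by (simp add: Dc.inv_y pow_x)
    moreover have "inv\<^bsub>Dc n\<^esub> dc_y n \<otimes>\<^bsub>Dc n\<^esub> ?y k = ?x k" for k
      by (simp add: Dc.inv_solve_left')
    ultimately show ?case using inv_y by metis
  qed
  then show ?thesis using x y by blast
qed

lemma Dc_hom_eqI: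
  assumes "group H" and h: "h \<in> hom (Dc n) H" and k: "k \<in> hom (Dc n) H"
    and x: "h (dc_x n) = k (dc_x n)" and y: "h (dc_y n) = k (dc_y n)"
    and g: "g \<in> carrier (Dc n)"
  shows "h g = k g"
proof -
  interpret H: group H by fact
  note pow = hom_int_pow[OF _ Dc.x_closed group_Dc H.is_group]
  from g show ?thesis
    by (cases rule: Dc_cases) (simp_all add: pow[OF h] pow[OF k] hom_mult[OF h] hom_mult[OF k] x y)
qed

text \<open>The pair \<open>(b, k)\<close> stands for \<open>x^k\<close> or \<open>y x^k\<close> according to \<open>b\<close>. The product is what the relations
  dictate: \<open>x^k\<close> is inverted when it passes a \<open>y\<close>, and \<open>y y\<close> contributes \<open>x^n\<close>.\<close>

definition dc_model :: "nat \<Rightarrow> (bool \<times> int) monoid" where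
  "dc_model n =
     \<lparr>carrier = UNIV \<times> {0..<int (2 * n)},
      monoid.mult = (\<lambda>(b, k) (c, l).
        (b \<noteq> c, ((if c then - k else k) + l + (if b \<and> c then int n else 0)) mod int (2 * n))),
      one = (False, 0)\<rparr>"

lemma dc_model_mult:
  "(b, k) \<otimes>\<^bsub>dc_model n\<^esub> (c, l) =
     (b \<noteq> c, ((if c then - k else k) + l + (if b \<and> c then int n else 0)) mod int (2 * n))"
  by (simp add: dc_model_def)

lemma mod_add3_eq:
  fixes u v w m :: int
  shows "(- (u mod m) + v + w) mod m = (- u + v + w) mod m"
    and "(u mod m + v + w) mod m = (u + v + w) mod m"
    and "(u + v mod m + w) mod m = (u + v + w) mod m"
  by (fold cong_def; intro cong_add cong_refl; simp add: cong_def mod_minus_eq)+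

lemma group_dc_model:
  assumes "n > 0"
  shows "group (dc_model n)"
proof (rule groupI)
  fix A B C
  assume "A \<in> carrier (dc_model n)" "B \<in> carrier (dc_model n)" "C \<in> carrier (dc_model n)"
  obtain a i b j c k where ABC: "A = (a, i)" "B = (b, j)" "C = (c, k)" by (meson surj_pair)
  \<comment> \<open>The case of three factors outside the cyclic part: the exponents produced by the two
    bracketings differ by \<open>2 * n\<close>. In all other cases they are equal as integers.\<close>
  have "(- (- i + j + int n) + k + 0) mod int (2 * n) = (i + (- j + k + int n) + 0) mod int (2 * n)"
    by (simp add: mod_eq_dvd_iff)
  then show "A \<otimes>\<^bsub>dc_model n\<^esub> B \<otimes>\<^bsub>dc_model n\<^esub> C = A \<otimes>\<^bsub>dc_model n\<^esub> (B \<otimes>\<^bsub>dc_model n\<^esub> C)"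
    unfolding ABC
    by (cases a; cases b; cases c)
      (simp_all only: dc_model_mult mod_add3_eq simp_thms if_True if_False prod.inject,
        simp_all add: algebra_simps)
next
  fix A assume "A \<in> carrier (dc_model n)"
  then obtain a i where A: "A = (a, i)" "0 \<le> i" "i < int (2 * n)"
    by (auto simp: dc_model_def)
  have "(a, (if a then i + int n else - i) mod int (2 * n)) \<otimes>\<^bsub>dc_model n\<^esub> A = \<one>\<^bsub>dc_model n\<^esub>"
    unfolding A
    by (cases a) (simp_all only: dc_model_mult mod_add3_eq simp_thms if_True if_False,
        simp_all add: dc_model_def)
  moreover have "(a, (if a then i + int n else - i) mod int (2 * n)) \<in> carrier (dc_model n)"
    using assms by (simp add: dc_model_def)
  ultimately show "\<exists>B\<in>carrier (dc_model n). B \<otimes>\<^bsub>dc_model n\<^esub> A = \<one>\<^bsub>dc_model n\<^esub>" by blast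
qed (use assms in \<open>auto simp: dc_model_def\<close>)

lemma dc_model_pow:
  assumes "k < 2 * n"
  shows "(False, 1) [^]\<^bsub>dc_model n\<^esub> k = (False, int k)"
  using assms
proof (induction k)
  case 0
  show ?case by (simp add: dc_model_def)
next
  case (Suc k)
  then show ?case by (simp add: dc_model_mult)
qed

lemma dicyclic_relations_model:
  assumes "n > 0"
  shows "dicyclic_relations (dc_model n) (False, 1) (True, 0) n"
proof -
  interpret group "dc_model n" using assms by (rule group_dc_model)
  have x: "(False, 1) \<in> carrier (dc_model n)" and y: "(True, 0) \<in> carrier (dc_model n)"
    using assms by (auto simp: dc_model_def)
  \<comment> \<open>The exponent wraps around only in the last of the \<open>2 * n\<close> multiplications.\<close>
  have "(False, 1) [^]\<^bsub>dc_model n\<^esub> Suc (2 * n - 1) =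
      (False, int (2 * n - 1)) \<otimes>\<^bsub>dc_model n\<^esub> (False, 1)"
    using assms by (simp only: nat_pow_Suc dc_model_pow)
  also have "\<dots> = \<one>\<^bsub>dc_model n\<^esub>"
    using assms by (simp add: dc_model_def of_nat_diff)
  finally have "(False, 1) [^]\<^bsub>dc_model n\<^esub> (2 * n) = \<one>\<^bsub>dc_model n\<^esub>"
    using assms by (simp del: nat_pow_Suc)
  moreover have inv_x: "inv\<^bsub>dc_model n\<^esub> (False, 1) = (False, int (2 * n) - 1)"
    using assms x by (intro inv_equality) (simp_all add: dc_model_mult, simp_all add: dc_model_def)
  moreover have "inv\<^bsub>dc_model n\<^esub> (True, 0) \<otimes>\<^bsub>dc_model n\<^esub> (False, 1) \<otimes>\<^bsub>dc_model n\<^esub> (True, 0) =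
      inv\<^bsub>dc_model n\<^esub> (False, 1)"
  proof -
    have "(False, 1) \<otimes>\<^bsub>dc_model n\<^esub> (True, 0) =
        (True, 0) \<otimes>\<^bsub>dc_model n\<^esub> inv\<^bsub>dc_model n\<^esub> (False, 1)"
      unfolding inv_x using assms by (simp add: dc_model_mult zmod_minus1)
    with x y show ?thesis
      by (simp only: m_assoc inv_closed m_closed inv_solve_left')
  qed
  moreover have "(True, 0) \<otimes>\<^bsub>dc_model n\<^esub> (True, 0) = (False, 1) [^]\<^bsub>dc_model n\<^esub> n"
    using assms by (simp add: dc_model_pow dc_model_mult)
  ultimately show ?thesis
    using x y by unfold_locales
qed

text \<open>Since \<open>Dc n\<close> maps to the model, powers of \<open>x\<close> that the model separates are distinct, and \<open>y\<close> is no
  power of \<open>x\<close>.\<close>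

lemma Dc_to_model:
  assumes "n > 0"
  obtains h where "h \<in> hom (Dc n) (dc_model n)" "h (dc_y n) = (True, 0)"
    "\<And>k::int. h (dc_x n [^]\<^bsub>Dc n\<^esub> k) = (False, k mod int (2 * n))"
proof -
  interpret M: dicyclic_relations "dc_model n" "(False, 1)" "(True, 0)" n
    using assms by (rule dicyclic_relations_model)
  obtain h where h: "h \<in> hom (Dc n) (dc_model n)"
    "h (dc_x n) = (False, 1)" "h (dc_y n) = (True, 0)"
    by (rule M.Dc_lift)
  have "h (dc_x n [^]\<^bsub>Dc n\<^esub> k) = (False, k mod int (2 * n))" for k :: int
  proof -
    define j where "j = nat (k mod int (2 * n))"
    have j: "int j = k mod int (2 * n)" "j < 2 * n"
      using assms by (simp_all add: j_def nat_less_iff)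
    have "h (dc_x n [^]\<^bsub>Dc n\<^esub> k) = (False, 1) [^]\<^bsub>dc_model n\<^esub> k"
      using hom_int_pow[OF h(1) Dc.x_closed group_Dc M.is_group] by (simp add: h(2))
    also have "\<dots> = (False, 1) [^]\<^bsub>dc_model n\<^esub> int j"
      by (rule M.x_pow_cong) (simp add: j(1) cong_def)
    also have "\<dots> = (False, int j)"
      using j(2) by (simp only: int_pow_int dc_model_pow)
    finally show ?thesis by (simp add: j(1))
  qed
  with h show ?thesis by (intro that[of h])
qed

lemma dc_x_pow_eq_iff:
  fixes i j :: int
  assumes "n > 0"
  shows "dc_x n [^]\<^bsub>Dc n\<^esub> i = dc_x n [^]\<^bsub>Dc n\<^esub> j \<longleftrightarrow> [i = j] (mod int (2 * n))"
proof
  obtain h where "\<And>k::int. h (dc_x n [^]\<^bsub>Dc n\<^esub> k) = (False, k mod int (2 * n))"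
    using Dc_to_model[OF assms] by blast
  then show "[i = j] (mod int (2 * n))" if "dc_x n [^]\<^bsub>Dc n\<^esub> i = dc_x n [^]\<^bsub>Dc n\<^esub> j"
    using that unfolding cong_def by (metis prod.inject)
qed (rule Dc.x_pow_cong)

lemma dc_y_x_pow_neq_x_pow:
  fixes i j :: int
  assumes "n > 0"
  shows "dc_y n \<otimes>\<^bsub>Dc n\<^esub> dc_x n [^]\<^bsub>Dc n\<^esub> i \<noteq> dc_x n [^]\<^bsub>Dc n\<^esub> j"
proof
  assume eq: "dc_y n \<otimes>\<^bsub>Dc n\<^esub> dc_x n [^]\<^bsub>Dc n\<^esub> i = dc_x n [^]\<^bsub>Dc n\<^esub> j"
  have "dc_y n = dc_x n [^]\<^bsub>Dc n\<^esub> (j - i)"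
    using eq by (simp add: Dc.int_pow_diff Dc.inv_solve_right)
  moreover obtain h where "h (dc_y n) = (True, 0::int)"
    "\<And>k::int. h (dc_x n [^]\<^bsub>Dc n\<^esub> k) = (False, k mod int (2 * n))"
    using Dc_to_model[OF assms] by blast
  ultimately show False by simp
qed

lemma dc_y_x_pow_eq_iff:
  fixes i j :: int
  assumes "n > 0"
  shows "dc_y n \<otimes>\<^bsub>Dc n\<^esub> dc_x n [^]\<^bsub>Dc n\<^esub> i = dc_y n \<otimes>\<^bsub>Dc n\<^esub> dc_x n [^]\<^bsub>Dc n\<^esub> j \<longleftrightarrow>
    [i = j] (mod int (2 * n))"
  using dc_x_pow_eq_iff[OF assms] by (simp add: Dc.l_cancel)


section \<open>The automorphisms of the dicyclic group\<close>

lemma Dc_hom_x_pow: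
  fixes a k :: int
  assumes "h \<in> hom (Dc n) (Dc n)" "h (dc_x n) = dc_x n [^]\<^bsub>Dc n\<^esub> a"
  shows "h (dc_x n [^]\<^bsub>Dc n\<^esub> k) = dc_x n [^]\<^bsub>Dc n\<^esub> (a * k)"
  using hom_int_pow[OF assms(1) Dc.x_closed group_Dc group_Dc]
  by (simp add: assms(2) Dc.int_pow_pow mult.commute)

lemma Dc_hom_y_x_pow:
  fixes a b k :: int
  assumes "h \<in> hom (Dc n) (Dc n)" "h (dc_x n) = dc_x n [^]\<^bsub>Dc n\<^esub> a"
    "h (dc_y n) = dc_y n \<otimes>\<^bsub>Dc n\<^esub> dc_x n [^]\<^bsub>Dc n\<^esub> b"
  shows "h (dc_y n \<otimes>\<^bsub>Dc n\<^esub> dc_x n [^]\<^bsub>Dc n\<^esub> k) = dc_y n \<otimes>\<^bsub>Dc n\<^esub> dc_x n [^]\<^bsub>Dc n\<^esub> (b + a * k)"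
  by (simp add: hom_mult[OF assms(1)] Dc_hom_x_pow[OF assms(1,2)] assms(3) Dc.m_assoc
      Dc.int_pow_mult)

text \<open>The universal property gives the endomorphism. Dividing exponents by the unit \<open>r\<close> shows that it
  is onto. Its kernel is trivial because elements \<open>y x^k\<close> keep their shape, and for \<open>x^k\<close> the
  congruence \<open>r k = 0\<close> modulo \<open>2 n\<close> forces \<open>k = 0\<close>.\<close>

lemma Dc_automorphism_exists:
  fixes r s :: int
  assumes "n > 0" "coprime r (int (2 * n))"
  obtains \<phi> where "\<phi> \<in> auto (Dc n)" "\<phi> (dc_x n) = dc_x n [^]\<^bsub>Dc n\<^esub> r"
    "\<phi> (dc_y n) = dc_y n \<otimes>\<^bsub>Dc n\<^esub> dc_x n [^]\<^bsub>Dc n\<^esub> s"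
proof -
  let ?X = "\<lambda>k::int. dc_x n [^]\<^bsub>Dc n\<^esub> k" and ?Y = "\<lambda>k::int. dc_y n \<otimes>\<^bsub>Dc n\<^esub> dc_x n [^]\<^bsub>Dc n\<^esub> k"
  have "odd r" using assms(2) by (auto simp: coprime_mult_right_iff)
  then interpret I: dicyclic_relations "Dc n" "?X r" "?Y s" n
    by (rule Dc.dicyclic_relations_image)
  obtain h where h: "h \<in> hom (Dc n) (Dc n)" "h (dc_x n) = ?X r" "h (dc_y n) = ?Y s"
    by (rule I.Dc_lift)
  note hX = Dc_hom_x_pow[OF h(1,2)] and hY = Dc_hom_y_x_pow[OF h]
  obtain r' where r': "[r * r' = 1] (mod int (2 * n))"
    using assms(2) cong_solve_coprime_int by blast
  have cong: "[r * (r' * k) = k] (mod int (2 * n))" for k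
    using cong_scalar_right[OF r', of k] by (simp add: mult.assoc)
  have "g \<in> h ` carrier (Dc n)" if "g \<in> carrier (Dc n)" for g
    using that
  proof (cases rule: Dc_cases)
    case (x k)
    have "h (?X (r' * k)) = ?X k"
      unfolding hX by (rule Dc.x_pow_cong[OF cong])
    then show ?thesis unfolding x by (metis Dc.int_pow_closed Dc.x_closed imageI)
  next
    case (y k)
    have "[s + r * (r' * (k - s)) = s + (k - s)] (mod int (2 * n))"
      by (intro cong_add cong_refl cong)
    then have "h (?Y (r' * (k - s))) = ?Y k"
      unfolding hY using Dc.x_pow_cong[of "s + r * (r' * (k - s))" k n] by simp
    then show ?thesis unfolding y
      by (metis Dc.int_pow_closed Dc.x_closed Dc.y_closed Dc.m_closed imageI)
  qed
  then have surj: "h ` carrier (Dc n) = carrier (Dc n)"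
    using hom_in_carrier[OF h(1)] by blast
  interpret h: group_hom "Dc n" "Dc n" h
    by (simp add: group_hom_def group_hom_axioms_def group_Dc h(1))
  have inj: "inj_on h (carrier (Dc n))"
    unfolding h.inj_on_one_iff
  proof (intro allI impI)
    fix g assume g: "g \<in> carrier (Dc n)" "h g = \<one>\<^bsub>Dc n\<^esub>"
    have one: "\<one>\<^bsub>Dc n\<^esub> = ?X 0" by simp
    from g(1) show "g = \<one>\<^bsub>Dc n\<^esub>"
    proof (cases rule: Dc_cases)
      case (x k)
      then have "[r * k = r * 0] (mod int (2 * n))"
        using g(2) by (simp only: one hX dc_x_pow_eq_iff[OF assms(1)]) simp
      then have "[k = 0] (mod int (2 * n))"
        using assms(2) cong_mult_lcancel by blast
      then show ?thesis unfolding x one by (rule Dc.x_pow_cong)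
    next
      case (y k)
      then show ?thesis
        using g(2) dc_y_x_pow_neq_x_pow[OF assms(1)] by (metis one hY)
    qed
  qed
  show ?thesis
  proof
    \<comment> \<open>Automorphisms are extensional functions, hence the restriction.\<close>
    let ?\<phi> = "restrict h (carrier (Dc n))"
    have "?\<phi> \<in> hom (Dc n) (Dc n)"
      by (rule homI) (simp_all add: hom_mult[OF h(1)] hom_in_carrier[OF h(1)])
    moreover have "bij_betw ?\<phi> (carrier (Dc n)) (carrier (Dc n))"
      using surj inj by (simp add: bij_betw_def inj_on_def)
    ultimately show "?\<phi> \<in> auto (Dc n)"
      by (simp add: auto_def Bij_def)
  qed (simp_all add: h)
qed

lemma auto_Dc_eqI:
  assumes "\<phi> \<in> auto (Dc n)" "\<psi> \<in> auto (Dc n)"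
    "\<phi> (dc_x n) = \<psi> (dc_x n)" "\<phi> (dc_y n) = \<psi> (dc_y n)"
  shows "\<phi> = \<psi>"
proof (rule extensionalityI)
  show "\<phi> \<in> extensional (carrier (Dc n))" "\<psi> \<in> extensional (carrier (Dc n))"
    using assms(1,2) by (simp_all add: auto_def Bij_def)
  show "\<phi> g = \<psi> g" if "g \<in> carrier (Dc n)" for g
    using Dc_hom_eqI[OF group_Dc[of n] _ _ assms(3,4) that] assms(1,2) by (simp add: auto_def)
qed

lemma dc_aut_spec:
  fixes r s :: int
  assumes "n > 0" "coprime r (int (2 * n))"
  shows dc_aut_in_auto: "dc_aut n r s \<in> auto (Dc n)"
    and dc_aut_x: "dc_aut n r s (dc_x n) = dc_x n [^]\<^bsub>Dc n\<^esub> r"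
    and dc_aut_y: "dc_aut n r s (dc_y n) = dc_y n \<otimes>\<^bsub>Dc n\<^esub> dc_x n [^]\<^bsub>Dc n\<^esub> s"
proof -
  let ?P = "\<lambda>\<phi>. \<phi> \<in> auto (Dc n) \<and> \<phi> (dc_x n) = dc_x n [^]\<^bsub>Dc n\<^esub> r \<and>
    \<phi> (dc_y n) = dc_y n \<otimes>\<^bsub>Dc n\<^esub> dc_x n [^]\<^bsub>Dc n\<^esub> s"
  obtain \<phi> where \<phi>: "\<phi> \<in> auto (Dc n)" "\<phi> (dc_x n) = dc_x n [^]\<^bsub>Dc n\<^esub> r"
    "\<phi> (dc_y n) = dc_y n \<otimes>\<^bsub>Dc n\<^esub> dc_x n [^]\<^bsub>Dc n\<^esub> s"
    by (rule Dc_automorphism_exists[OF assms])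
  have "\<exists>!\<phi>. ?P \<phi>"
  proof (rule ex1I)
    show "?P \<phi>" using \<phi> by simp
    show "\<psi> = \<phi>" if "?P \<psi>" for \<psi>
      using that \<phi> by (intro auto_Dc_eqI[of \<psi> n \<phi>]) simp_all
  qed
  then have "?P (dc_aut n r s)"
    unfolding dc_aut_def by (rule theI')
  then show "dc_aut n r s \<in> auto (Dc n)" "dc_aut n r s (dc_x n) = dc_x n [^]\<^bsub>Dc n\<^esub> r"
    "dc_aut n r s (dc_y n) = dc_y n \<otimes>\<^bsub>Dc n\<^esub> dc_x n [^]\<^bsub>Dc n\<^esub> s" by simp_all
qed

text \<open>Orders of elements decide where \<open>x\<close> goes: \<open>y x^k\<close> has order dividing 4, and \<open>x\<close> has order
  \<open>2 n > 4\<close>. If \<open>y\<close> went to a power of \<open>x\<close> too, the image would be cyclic and miss \<open>y\<close>. Finally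
  \<open>x\<close> itself must be a value \<open>\<sigma>(x^k) = x^(a k)\<close>, which makes \<open>a\<close> invertible.\<close>

lemma auto_Dc_cases:
  assumes n: "n > 2" and \<sigma>: "\<sigma> \<in> auto (Dc n)"
  obtains a b :: int where "coprime a (int (2 * n))"
    "\<sigma> (dc_x n) = dc_x n [^]\<^bsub>Dc n\<^esub> a"
    "\<sigma> (dc_y n) = dc_y n \<otimes>\<^bsub>Dc n\<^esub> dc_x n [^]\<^bsub>Dc n\<^esub> b"
proof -
  let ?X = "\<lambda>k::int. dc_x n [^]\<^bsub>Dc n\<^esub> k" and ?Y = "\<lambda>k::int. dc_y n \<otimes>\<^bsub>Dc n\<^esub> dc_x n [^]\<^bsub>Dc n\<^esub> k"
  have n0: "n > 0" using n by simp
  have hom: "\<sigma> \<in> hom (Dc n) (Dc n)" and inj: "inj_on \<sigma> (carrier (Dc n))"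
    and surj: "\<sigma> ` carrier (Dc n) = carrier (Dc n)"
    using \<sigma> by (simp_all add: auto_def Bij_def bij_betw_def)
  have "\<exists>a. \<sigma> (dc_x n) = ?X a"
  proof (rule ccontr)
    assume "\<nexists>a. \<sigma> (dc_x n) = ?X a"
    then obtain k where k: "\<sigma> (dc_x n) = ?Y k"
      by - (rule Dc_cases[OF hom_in_carrier[OF hom Dc.x_closed]], blast+)
    have two: "\<sigma> (?X 2) = ?X (int n)"
    proof -
      have "?X 2 = dc_x n \<otimes>\<^bsub>Dc n\<^esub> dc_x n"
        using Dc.int_pow_mult[OF Dc.x_closed, of n 1 1] by simp
      then show ?thesis by (simp add: hom_mult[OF hom] k Dc.y_x_pow_square)
    qed
    have "?X 4 = ?X 2 \<otimes>\<^bsub>Dc n\<^esub> ?X 2"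
      using Dc.int_pow_mult[OF Dc.x_closed, of n 2 2] by simp
    then have "\<sigma> (?X 4) = ?X (int n) \<otimes>\<^bsub>Dc n\<^esub> ?X (int n)"
      by (simp add: hom_mult[OF hom] two)
    also have "\<dots> = ?X (int n + int n)"
      by (simp only: Dc.int_pow_mult Dc.x_closed)
    also have "\<dots> = ?X 0"
      by (rule Dc.x_pow_cong) (simp add: cong_def)
    also have "\<dots> = \<sigma> (?X 0)"
      using hom_one[OF hom group_Dc group_Dc] by simp
    finally have "?X 4 = ?X 0"
      using inj by (simp only: inj_on_eq_iff Dc.int_pow_closed Dc.x_closed)
    then have "[4 = 0] (mod int (2 * n))"
      by (simp only: dc_x_pow_eq_iff[OF n0])
    then have "int (2 * n) dvd 4" by (simp add: cong_0_iff)
    then show False using n zdvd_imp_le by fastforce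
  qed
  then obtain a where a: "\<sigma> (dc_x n) = ?X a" by blast
  note \<sigma>X = Dc_hom_x_pow[OF hom a]
  have "\<exists>b. \<sigma> (dc_y n) = ?Y b"
  proof (rule ccontr)
    assume "\<nexists>b. \<sigma> (dc_y n) = ?Y b"
    then obtain b where b: "\<sigma> (dc_y n) = ?X b"
      by - (rule Dc_cases[OF hom_in_carrier[OF hom Dc.y_closed]], blast+)
    have "?Y 0 \<in> \<sigma> ` carrier (Dc n)"
      unfolding surj by simp
    then obtain g where g: "g \<in> carrier (Dc n)" "\<sigma> g = ?Y 0"
      by (metis imageE)
    from g(1) have "\<exists>k. \<sigma> g = ?X k"
    proof (cases rule: Dc_cases)
      case (x k)
      then show ?thesis using \<sigma>X by auto
    next
      case (y k)
      then have "\<sigma> g = ?X (b + a * k)" by (simp add: hom_mult[OF hom] \<sigma>X b Dc.int_pow_mult)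
      then show ?thesis by blast
    qed
    then show False using g(2) dc_y_x_pow_neq_x_pow[OF n0] by metis
  qed
  then obtain b where b: "\<sigma> (dc_y n) = ?Y b" by blast
  have "?X 1 \<in> \<sigma> ` carrier (Dc n)"
    unfolding surj by simp
  then obtain g where g: "g \<in> carrier (Dc n)" "\<sigma> g = ?X 1"
    by (metis imageE)
  from g(1) have "coprime a (int (2 * n))"
  proof (cases rule: Dc_cases)
    case (x k)
    then have "[a * k = 1] (mod int (2 * n))"
      using g(2) by (simp only: \<sigma>X dc_x_pow_eq_iff[OF n0])
    then show ?thesis using coprime_iff_invertible_int by blast
  next
    case (y k)
    then have "?Y (b + a * k) = ?X 1"
      using g(2) by (simp only: Dc_hom_y_x_pow[OF hom a b])
    then show ?thesis using dc_y_x_pow_neq_x_pow[OF n0] by blast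
  qed
  then show ?thesis using a b that by blast
qed


section \<open>Conjugate automorphisms\<close>

text \<open>Both composites are automorphisms, so comparing them on \<open>x\<close> and \<open>y\<close> is enough. The two congruences
  compare the exponents of the values there.\<close>

lemma dc_aut_intertwine_iff:
  fixes a b r s p q :: int
  assumes "n > 0" and \<sigma>: "\<sigma> \<in> auto (Dc n)"
    "\<sigma> (dc_x n) = dc_x n [^]\<^bsub>Dc n\<^esub> a"
    "\<sigma> (dc_y n) = dc_y n \<otimes>\<^bsub>Dc n\<^esub> dc_x n [^]\<^bsub>Dc n\<^esub> b"
    and r: "coprime r (int (2 * n))" and p: "coprime p (int (2 * n))"
  shows "compose (carrier (Dc n)) \<sigma> (dc_aut n r s) = compose (carrier (Dc n)) (dc_aut n p q) \<sigma> \<longleftrightarrow>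
    [a * r = p * a] (mod int (2 * n)) \<and> [b + a * s = q + p * b] (mod int (2 * n))"
proof -
  let ?C = "carrier (Dc n)" and ?\<phi> = "dc_aut n r s" and ?\<theta> = "dc_aut n p q"
  note \<phi> = dc_aut_spec[OF assms(1) r, of s] and \<theta> = dc_aut_spec[OF assms(1) p, of q]
  have hom: "\<sigma> \<in> hom (Dc n) (Dc n)" "?\<theta> \<in> hom (Dc n) (Dc n)"
    using \<sigma>(1) \<theta>(1) by (simp_all add: auto_def)
  have comp: "compose ?C f g \<in> auto (Dc n)" if "f \<in> auto (Dc n)" "g \<in> auto (Dc n)" for f g
    using that Dc.hom_compose[of g n "Dc n" f "Dc n"] by (simp add: auto_def compose_Bij)
  have "compose ?C \<sigma> ?\<phi> = compose ?C ?\<theta> \<sigma> \<longleftrightarrow>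
      \<sigma> (?\<phi> (dc_x n)) = ?\<theta> (\<sigma> (dc_x n)) \<and> \<sigma> (?\<phi> (dc_y n)) = ?\<theta> (\<sigma> (dc_y n))"
    (is "?eq \<longleftrightarrow> ?gens")
  proof
    assume ?eq
    then show ?gens by (metis compose_eq Dc.x_closed Dc.y_closed)
  next
    assume ?gens
    then show ?eq
      using comp \<sigma>(1) \<phi>(1) \<theta>(1) by (intro auto_Dc_eqI[of _ n]) (simp_all add: compose_eq)
  qed
  also have "\<dots> \<longleftrightarrow> [a * r = p * a] (mod int (2 * n)) \<and> [b + a * s = q + p * b] (mod int (2 * n))"
    unfolding \<phi>(2,3) \<sigma>(2,3) Dc_hom_x_pow[OF hom(1) \<sigma>(2)] Dc_hom_x_pow[OF hom(2) \<theta>(2)]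
      Dc_hom_y_x_pow[OF hom(1) \<sigma>(2,3)] Dc_hom_y_x_pow[OF hom(2) \<theta>(2,3)]
      dc_x_pow_eq_iff[OF assms(1)] dc_y_x_pow_eq_iff[OF assms(1)] ..
  finally show ?thesis .
qed

lemma isomorphic_dc_auts_iff_cong:
  fixes r s p q :: int
  assumes n: "n > 2" and r: "coprime r (int (2 * n))" and p: "coprime p (int (2 * n))"
  shows "isomorphic_auts (Dc n) (dc_aut n r s) (dc_aut n p q) \<longleftrightarrow>
    (\<exists>a b. coprime a (int (2 * n)) \<and>
      [a * r = p * a] (mod int (2 * n)) \<and> [b + a * s = q + p * b] (mod int (2 * n)))"
    (is "?iso \<longleftrightarrow> (\<exists>a b. ?Q a b)")
proof
  have n0: "n > 0" using n by simp
  note intertwine = dc_aut_intertwine_iff[OF n0 _ _ _ r p, of _ _ _ s q]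
  show "\<exists>a b. ?Q a b" if ?iso
  proof -
    from that obtain \<sigma> where \<sigma>: "\<sigma> \<in> auto (Dc n)"
      "compose (carrier (Dc n)) \<sigma> (dc_aut n r s) = compose (carrier (Dc n)) (dc_aut n p q) \<sigma>"
      by (auto simp: isomorphic_auts_def)
    from n \<sigma>(1) show ?thesis
    proof (rule auto_Dc_cases)
      fix a b :: int
      assume "coprime a (int (2 * n))" "\<sigma> (dc_x n) = dc_x n [^]\<^bsub>Dc n\<^esub> a"
        "\<sigma> (dc_y n) = dc_y n \<otimes>\<^bsub>Dc n\<^esub> dc_x n [^]\<^bsub>Dc n\<^esub> b"
      with \<sigma> intertwine[of \<sigma> a b] show ?thesis by blast
    qed
  qed
  show ?iso if "\<exists>a b. ?Q a b"
  proof -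
    from that obtain a b where ab: "?Q a b" by blast
    then have "coprime a (int (2 * n))" by blast
    note \<sigma> = dc_aut_spec[OF n0 this, of b]
    show ?thesis
      unfolding isomorphic_auts_def
      using \<sigma>(1) intertwine[OF \<sigma>] ab dc_aut_in_auto[OF n0 r] dc_aut_in_auto[OF n0 p] by blast
  qed
qed

text \<open>The two sides are related by \<open>u = 1/a\<close> and \<open>c = - u b\<close>, that is \<open>b = - a c\<close>.\<close>

lemma conjugacy_cong_iff:
  fixes r s p q m :: int
  shows "(\<exists>a b. coprime a m \<and> [a * r = p * a] (mod m) \<and> [b + a * s = q + p * b] (mod m)) \<longleftrightarrow>
    [r = p] (mod m) \<and> (\<exists>u c. coprime u m \<and> [q * u - s = (r - 1) * c] (mod m))"
    (is "?L \<longleftrightarrow> ?R")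
proof
  assume ?L
  then obtain a b where a: "coprime a m" and ar: "[a * r = p * a] (mod m)"
    and ab: "[b + a * s = q + p * b] (mod m)" by blast
  have rp: "[r = p] (mod m)"
    using ar a by (simp add: mult.commute[of p] cong_mult_lcancel)
  obtain u where u: "[a * u = 1] (mod m)"
    using a cong_solve_coprime_int by blast
  have dv: "m dvd a * u - 1" "m dvd r - p" "m dvd (b + a * s) - (q + p * b)"
    using u rp ab by (simp_all add: cong_iff_dvd_diff)
  have "q * u - s - (r - 1) * (- u * b) =
      s * (a * u - 1) + u * b * (r - p) - u * ((b + a * s) - (q + p * b))"
    by (simp add: algebra_simps)
  also have "m dvd \<dots>" by (simp only: dv dvd_add dvd_diff dvd_mult)
  finally have "[q * u - s = (r - 1) * (- u * b)] (mod m)" by (simp add: cong_iff_dvd_diff)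
  moreover have "coprime u m"
    using u by (metis coprime_iff_invertible_int mult.commute)
  ultimately show ?R using rp by blast
next
  assume ?R
  then obtain u c where rp: "[r = p] (mod m)" and u: "coprime u m"
    and c: "[q * u - s = (r - 1) * c] (mod m)" by blast
  obtain a where a: "[u * a = 1] (mod m)"
    using u cong_solve_coprime_int by blast
  have dv: "m dvd u * a - 1" "m dvd r - p" "m dvd q * u - s - (r - 1) * c"
    using a rp c by (simp_all add: cong_iff_dvd_diff)
  have "(- a * c + a * s) - (q + p * (- a * c)) =
      q * (u * a - 1) - a * (q * u - s - (r - 1) * c) - a * c * (r - p)"
    by (simp add: algebra_simps)
  also have "m dvd \<dots>" by (simp only: dv dvd_diff dvd_mult)
  finally have "[- a * c + a * s = q + p * (- a * c)] (mod m)" by (simp add: cong_iff_dvd_diff)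
  moreover have "[a * r = p * a] (mod m)"
    using cong_scalar_left[OF rp, of a] by (simp add: mult.commute)
  moreover have "coprime a m"
    using a by (metis coprime_iff_invertible_int mult.commute)
  ultimately show ?L by blast
qed

lemma (in residues) minus_eq_mod: "x \<ominus> y = (x - y) mod m"
  by (simp add: a_minus_def res_neg_eq res_add_eq mod_simps)

text \<open>Divisibility in the residue ring is stated with a cofactor in the carrier; reducing an arbitrary
  integer cofactor modulo \<open>m\<close> supplies one.\<close>

lemma (in residues) divides_iff_cong:
  assumes "b \<in> carrier R"
  shows "(a mod m) divides b \<longleftrightarrow> (\<exists>c. [b = a * c] (mod m))"
proof -
  have b: "b mod m = b" using assms by (simp add: res_carrier_eq)
  have "(a mod m) divides b \<longleftrightarrow> (\<exists>c\<in>carrier R. [b = a * c] (mod m))"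
    unfolding factor_def by (simp add: res_mult_eq mod_simps cong_def b)
  also have "\<dots> \<longleftrightarrow> (\<exists>c. [b = a * c] (mod m))"
  proof
    assume "\<exists>c. [b = a * c] (mod m)"
    then obtain c where "[b = a * (c mod m)] (mod m)" by (auto simp: cong_def mod_simps)
    then show "\<exists>c\<in>carrier R. [b = a * c] (mod m)" by blast
  qed blast
  finally show ?thesis .
qed

theorem proposition2p12:
  fixes n :: nat and r s p q :: int
  assumes "n > 2"
    and "r \<in> Units (Z2n n)" and "p \<in> Units (Z2n n)"
    and "s \<in> carrier (Z2n n)" and "q \<in> carrier (Z2n n)"
  shows "isomorphic_auts (Dc n) (dc_aut n r s) (dc_aut n p q) \<longleftrightarrow>
    r = p \<and>
    (\<exists>u\<in>Units (Z2n n).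
       (r \<ominus>\<^bsub>Z2n n\<^esub> \<one>\<^bsub>Z2n n\<^esub>) divides\<^bsub>Z2n n\<^esub> (q \<otimes>\<^bsub>Z2n n\<^esub> u \<ominus>\<^bsub>Z2n n\<^esub> s))"
proof -
  let ?m = "int (2 * n)"
  interpret residues ?m "Z2n n"
    using assms(1) by unfold_locales simp_all
  have r: "0 < r" "r < ?m" "coprime r ?m" and p: "0 < p" "p < ?m" "coprime p ?m"
    using assms(2,3) by (simp_all only: res_units_eq mem_Collect_eq)
  have rp: "[r = p] (mod ?m) \<longleftrightarrow> r = p"
    using r p by (simp add: cong_def)
  have div: "(r \<ominus>\<^bsub>Z2n n\<^esub> \<one>\<^bsub>Z2n n\<^esub>) divides\<^bsub>Z2n n\<^esub> (q \<otimes>\<^bsub>Z2n n\<^esub> u \<ominus>\<^bsub>Z2n n\<^esub> s) \<longleftrightarrow>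
      (\<exists>c. [q * u - s = (r - 1) * c] (mod ?m))" for u
    unfolding minus_eq_mod res_one_eq res_mult_eq
    by (subst divides_iff_cong[OF mod_in_carrier]) (simp add: cong_def mod_simps)
  have unit: "(\<exists>u\<in>Units (Z2n n). \<exists>c. [q * u - s = (r - 1) * c] (mod ?m)) \<longleftrightarrow>
      (\<exists>u c. coprime u ?m \<and> [q * u - s = (r - 1) * c] (mod ?m))" (is "?L \<longleftrightarrow> ?R")
  proof
    assume ?L
    moreover have "coprime u ?m" if "u \<in> Units (Z2n n)" for u
      using that by (simp only: res_units_eq mem_Collect_eq)
    ultimately show ?R by blast
  next
    assume ?R
    then obtain u c where u: "coprime u ?m" and c: "[q * u - s = (r - 1) * c] (mod ?m)" by blast
    have "[q * (u mod ?m) - s = q * u - s] (mod ?m)"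
      by (intro cong_diff cong_mult cong_refl) (simp add: cong_def)
    then have "[q * (u mod ?m) - s = (r - 1) * c] (mod ?m)"
      using c by (rule cong_trans)
    with mod_in_res_units[OF m_gt_one u] show ?L by blast
  qed
  show ?thesis
    unfolding isomorphic_dc_auts_iff_cong[OF assms(1) r(3) p(3)] conjugacy_cong_iff rp div unit ..
qed

end
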